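(* Let $N, W$ be natural numbers with $4N \le W^2$ and $W < N$. Then every integer $a$ with $0 < a < N$ has an orbit point in the window $[N-W, N)$, i.e. there exists $k \ge 0$ with $N - W \le h^{[k]}(a) < N$. Hence, if $t$ is an integer such that $m \sim t$ for every integer $m$ with $N - W \le m < N$, then $a \sim t$ for every integer $a$ with $0 < a < N$.
   Context: For a positive integer $n$, $\tau(n)$ is the number of positive divisors of $n$, and $h(n) = n + \tau(n)$; $h^{[k]}$ denotes the $k$-th iterate of $h$ ($h^{[0]}$ is the identity). Write $a \sim b$ ("$a$ and $b$ coalesce") if there exist integers $i,j \ge 0$ with $h^{[i]}(a) = h^{[j]}(b)$. The integer $t$ is a natural number. *)

theory Defs
  imports Main
begin

(* The argument is meant to be positive; since card of an infinite set is 0,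
   tau 0 = 0 and h 0 = 0, so 0 coalesces with no positive number. *)
definition tau :: "nat \<Rightarrow> nat" where
  "tau n = card {d. d dvd n}"

definition h :: "nat \<Rightarrow> nat" where
  "h n = n + tau n"

definition coalesce :: "nat \<Rightarrow> nat \<Rightarrow> bool" where
  "coalesce a b \<longleftrightarrow> (\<exists>i j. (h ^^ i) a = (h ^^ j) b)"

end

theory Submission
  imports Defs "HOL-Library.Discrete_Functions"
begin

text \<open>
  The divisors of \<open>n\<close> pair up as \<open>d\<close> and \<open>n div d\<close>, and one member of each pair is at most
  the square root of \<open>n\<close>. Hence \<open>tau n ^ 2 \<le> 4 * n\<close>, so below \<open>N\<close> a single step of \<open>h\<close>
  has length at most \<open>W\<close> (lemma \<open>tau_sq_le\<close>). Since \<open>h\<close> strictly increases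
  positive numbers, an orbit that starts below \<open>N\<close> eventually leaves \<open>{..<N}\<close>, and the last point
  before it does so is too close to \<open>N\<close> to lie below \<open>N - W\<close>. The claim about coalescence
  follows because \<open>coalesce\<close> is inherited backwards along an orbit.
\<close>

text \<open>
  With \<open>S\<close> the set of divisors up to the square root, every other divisor is the cofactor of
  an element of \<open>S\<close>, since two factors above the square root would have a product
  exceeding \<open>n\<close>.
\<close>

lemma tau_le_floor_sqrt:
  assumes "n > 0"
  shows "tau n \<le> 2 * floor_sqrt n"
proof -
  define S where "S = {d. d dvd n \<and> d \<le> floor_sqrt n}"
  have sub: "S \<subseteq> {1..floor_sqrt n}"
    using assms by (auto simp: S_def Suc_le_eq dvd_pos_nat)
  then have fin: "finite S"
    by (rule finite_subset) simp
  have cS: "card S \<le> floor_sqrt n"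
    using card_mono[OF _ sub] by simp
  have "{d. d dvd n} \<subseteq> S \<union> (\<lambda>d. n div d) ` S"
  proof
    fix d assume "d \<in> {d. d dvd n}"
    then obtain e where e: "n = d * e" by auto
    show "d \<in> S \<union> (\<lambda>d. n div d) ` S"
    proof (cases "d \<le> floor_sqrt n")
      case True
      then show ?thesis using e by (simp add: S_def)
    next
      case False
      have "e \<le> floor_sqrt n"
      proof (rule ccontr)
        assume "\<not> e \<le> floor_sqrt n"
        with False have "Suc (floor_sqrt n) * Suc (floor_sqrt n) \<le> d * e"
          by (intro mult_le_mono) auto
        then show False
          using Suc_floor_sqrt_power2_gt[of n] e by (simp add: power2_eq_square)
      qed
      then have "e \<in> S" using e by (simp add: S_def)
      moreover have "d = n div e" using e assms by auto
      ultimately show ?thesis by blast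
    qed
  qed
  then have "tau n \<le> card (S \<union> (\<lambda>d. n div d) ` S)"
    unfolding tau_def using fin by (intro card_mono) auto
  also have "\<dots> \<le> card S + card ((\<lambda>d. n div d) ` S)"
    by (rule card_Un_le)
  also have "\<dots> \<le> card S + card S"
    using card_image_le[OF fin] by simp
  finally show ?thesis using cS by linarith
qed

lemma tau_sq_le:
  assumes "n > 0"
  shows "(tau n)\<^sup>2 \<le> 4 * n"
proof -
  have "(tau n)\<^sup>2 \<le> (2 * floor_sqrt n)\<^sup>2"
    using tau_le_floor_sqrt[OF assms] by (rule power_mono) simp
  also have "\<dots> \<le> 4 * n"
    using floor_sqrt_power2_le[of n] by (simp add: power_mult_distrib)
  finally show ?thesis .
qed

lemma h_gt:
  assumes "n > 0"
  shows "h n > n"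
proof -
  have "finite {d. d dvd n}" using assms by simp
  moreover have "1 \<in> {d. d dvd n}" by simp
  ultimately have "tau n > 0"
    unfolding tau_def card_gt_0_iff by blast
  then show ?thesis by (simp add: h_def)
qed

lemma funpow_h_ge:
  assumes "a > 0"
  shows "(h ^^ k) a \<ge> a + k"
proof (induction k)
  case (Suc k)
  with assms have "h ((h ^^ k) a) > (h ^^ k) a" by (intro h_gt) linarith
  with Suc show ?case by simp
qed simp

text \<open>
  The window is met by the last orbit point \<open>b < N\<close>: its step \<open>tau b\<close> carries it
  to \<open>N\<close> or beyond, yet is at most \<open>W\<close>.
\<close>

lemma orbit_meets_window:
  fixes N W a :: nat
  assumes W: "4 * N \<le> W\<^sup>2" and a: "0 < a" "a < N"
  shows "\<exists>k. N - W \<le> (h ^^ k) a \<and> (h ^^ k) a < N"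
proof -
  have "\<exists>k. N \<le> (h ^^ k) a"
    using funpow_h_ge[OF a(1), of N] by (intro exI[of _ N]) linarith
  then obtain k where exit: "N \<le> (h ^^ k) a" and before: "\<forall>i<k. \<not> N \<le> (h ^^ i) a"
    using exists_least_iff[of "\<lambda>k. N \<le> (h ^^ k) a"] by blast
  from exit a obtain j where j: "k = Suc j" by (cases k) auto
  define b where "b = (h ^^ j) a"
  have bN: "b < N" using before j by (auto simp: b_def)
  have "b > 0" using funpow_h_ge[OF a(1), of j] a by (simp add: b_def)
  then have "(tau b)\<^sup>2 \<le> W\<^sup>2" using tau_sq_le[of b] W bN by linarith
  then have "tau b \<le> W" by (rule power2_le_imp_le) simp
  moreover have "N \<le> b + tau b" using exit j by (simp add: b_def h_def)
  ultimately have "N - W \<le> b" by linarith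
  with bN show ?thesis unfolding b_def by blast
qed

lemma coalesce_funpow_h:
  assumes "coalesce ((h ^^ k) a) t"
  shows "coalesce a t"
proof -
  from assms obtain i j where "(h ^^ (i + k)) a = (h ^^ j) t"
    by (auto simp: coalesce_def funpow_add)
  then show ?thesis unfolding coalesce_def by blast
qed

theorem mainTheorem3:
  fixes N W :: nat
  assumes "4 * N \<le> W ^ 2" and "W < N"
  shows "(\<forall>a. 0 < a \<and> a < N \<longrightarrow> (\<exists>k. N - W \<le> (h ^^ k) a \<and> (h ^^ k) a < N))
    \<and> (\<forall>t. (\<forall>m. N - W \<le> m \<and> m < N \<longrightarrow> coalesce m t)
          \<longrightarrow> (\<forall>a. 0 < a \<and> a < N \<longrightarrow> coalesce a t))"
  using orbit_meets_window[OF assms(1)] coalesce_funpow_h by blast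

end
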